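(* Let $G$ be a connected $d$-regular graph of order $n$. Then $G$ is resistance regular if and only if $$\sum_{j\in N(i)}L_{ij}^+=\frac{d}{n^2}\,Kf(G)+\frac1n-1\quad\text{for all } i\in V(G).$$
   Context: All graphs are finite, simple, undirected and connected. A graph is $d$-regular if all vertex degrees equal $d$. $N(i)$ is the set of vertices adjacent to $i$. $L^+$ is the Moore-Penrose inverse of the Laplacian matrix $L=D-A$ of $G$. The resistance distance $r_{ij}$ is the effective resistance between vertices $i$ and $j$ when each edge of $G$ carries a unit resistance; equivalently (known fact) $r_{ij}=L_{ii}^++L_{jj}^+-2L_{ij}^+$. The resistance matrix is $R(G)=(r_{ij})$; $G$ is resistance regular if all row sums of $R(G)$ are equal. The Kirchhoff index is $Kf(G)=\frac12\sum_{i,j\in V(G)}r_{ij}$. *)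

theory Defs
  imports "HOL-Analysis.Analysis" "Graph_Theory.Graph_Theory"
begin

text \<open>
  A finite simple undirected graph is a \<^locale>\<open>pair_graph\<close>, i.e. a finite, loop-free digraph
  with a symmetric arc relation; every edge is represented by its two opposite arcs.
  The matrices below are indexed by the vertex type, so they are meant for graphs whose
  vertex set is the whole (finite) type.
\<close>

definition neighborhood :: "'v pair_pre_digraph \<Rightarrow> 'v \<Rightarrow> 'v set" where
  "neighborhood G i = {j \<in> pverts G. (i, j) \<in> parcs G}"

text \<open>As each edge appears as two opposite arcs, the vertex degree is the out-degree.\<close>

definition vertex_degree :: "'v pair_pre_digraph \<Rightarrow> 'v \<Rightarrow> nat" where
  "vertex_degree G i = out_degree (with_proj G) i"

definition regular_graph :: "'v pair_pre_digraph \<Rightarrow> nat \<Rightarrow> bool" where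
  "regular_graph G d \<longleftrightarrow> (\<forall>i\<in>pverts G. vertex_degree G i = d)"

definition degree_matrix :: "('v::finite) pair_pre_digraph \<Rightarrow> real^'v^'v" where
  "degree_matrix G = (\<chi> i j. if i = j then real (vertex_degree G i) else 0)"

definition adjacency_matrix :: "('v::finite) pair_pre_digraph \<Rightarrow> real^'v^'v" where
  "adjacency_matrix G = (\<chi> i j. if (i, j) \<in> parcs G then 1 else 0)"

definition laplacian :: "('v::finite) pair_pre_digraph \<Rightarrow> real^'v^'v" where
  "laplacian G = degree_matrix G - adjacency_matrix G"

text \<open>The four Penrose equations; they have exactly one solution for every real matrix.\<close>

definition is_moore_penrose_inverse :: "real^'n^'m \<Rightarrow> real^'m^'n \<Rightarrow> bool" where
  "is_moore_penrose_inverse M X \<longleftrightarrow>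
     M ** X ** M = M \<and> X ** M ** X = X \<and>
     transpose (M ** X) = M ** X \<and> transpose (X ** M) = X ** M"

definition moore_penrose_inverse :: "real^'n^'m \<Rightarrow> real^'m^'n" where
  "moore_penrose_inverse M = (THE X. is_moore_penrose_inverse M X)"

text \<open>
  \<open>p\<close> is an electric potential for the network in which every edge is a unit resistor, a
  unit current enters at \<open>s\<close> and leaves at \<open>t\<close>. By Ohm's law the current along an edge from
  \<open>k\<close> to \<open>l\<close> is \<open>p k - p l\<close>; the equation is Kirchhoff's current law at \<open>k\<close>
  (for \<open>s = t\<close> there is no net external current).
\<close>

definition unit_current_potential ::
    "'v pair_pre_digraph \<Rightarrow> 'v \<Rightarrow> 'v \<Rightarrow> ('v \<Rightarrow> real) \<Rightarrow> bool" where
  "unit_current_potential G s t p \<longleftrightarrow>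
     (\<forall>k\<in>pverts G. (\<Sum>l\<in>neighborhood G k. p k - p l) = of_bool (k = s) - of_bool (k = t))"

text \<open>
  The effective resistance is the potential difference between \<open>s\<close> and \<open>t\<close> under a unit
  current. In a connected graph the potential exists and is unique up to an additive constant,
  so the difference is well defined.
\<close>

definition resistance_distance :: "'v pair_pre_digraph \<Rightarrow> 'v \<Rightarrow> 'v \<Rightarrow> real" where
  "resistance_distance G s t = (THE r. \<exists>p. unit_current_potential G s t p \<and> r = p s - p t)"

definition resistance_matrix :: "('v::finite) pair_pre_digraph \<Rightarrow> real^'v^'v" where
  "resistance_matrix G = (\<chi> i j. resistance_distance G i j)"

definition resistance_regular :: "('v::finite) pair_pre_digraph \<Rightarrow> bool" where
  "resistance_regular G \<longleftrightarrow>
     (\<exists>c. \<forall>i\<in>pverts G. (\<Sum>j\<in>pverts G. resistance_matrix G $ i $ j) = c)"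

definition kirchhoff_index :: "'v pair_pre_digraph \<Rightarrow> real" where
  "kirchhoff_index G = 1/2 * (\<Sum>i\<in>pverts G. \<Sum>j\<in>pverts G. resistance_distance G i j)"

end

theory Submission
  imports Defs
begin

text \<open>
  Let \<open>K\<close> be the matrix with all entries \<open>1/n\<close>. For a connected graph \<open>L + K\<close> is invertible, and
  \<open>(L + K)\<inverse> - K\<close> satisfies the Penrose equations with \<open>L L\<^sup>+ = L\<^sup>+ L = I - K\<close>. Hence the
  \<open>i\<close>-th row sum of the resistance matrix is \<open>n L\<^sup>+\<^sub>i\<^sub>i + tr L\<^sup>+\<close>, so that resistance regularity means
  that the diagonal of \<open>L\<^sup>+\<close> is constant, and \<open>Kf = n tr L\<^sup>+\<close>. On the other hand, the diagonal of
  \<open>L L\<^sup>+ = I - K\<close> reads \<open>d L\<^sup>+\<^sub>i\<^sub>i - (\<Sum>j\<in>N(i). L\<^sup>+\<^sub>i\<^sub>j) = 1 - 1/n\<close>.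
\<close>

section \<open>The Moore-Penrose inverse\<close>

lemma matrix_diff_ldistrib: "A ** (B - C) = A ** B - A ** (C :: real^'n^'m)"
  by (simp add: vec_eq_iff matrix_matrix_mult_def right_diff_distrib sum_subtractf)

lemma matrix_diff_rdistrib: "(B - C) ** A = B ** A - C ** (A :: real^'n^'m)"
  by (simp add: vec_eq_iff matrix_matrix_mult_def left_diff_distrib sum_subtractf)

lemma matrix_add_rdistrib: "(B + C) ** A = B ** A + C ** (A :: real^'n^'m)"
  by (simp add: vec_eq_iff matrix_matrix_mult_def distrib_right sum.distrib)

lemma transpose_diff: "transpose (A - B) = transpose A - transpose (B :: real^'n^'m)"
  by (simp add: vec_eq_iff transpose_def)

text \<open>Both \<open>M ** X\<close> and \<open>M ** Y\<close> are symmetric, so inserting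
  \<open>M = M ** Y ** M\<close> and transposing gives \<open>M ** X = M ** Y\<close>. Dually
  \<open>X ** M = Y ** M\<close>, and \<open>X ** M ** X\<close> turns into
  \<open>Y ** M ** Y\<close>.\<close>

lemma is_moore_penrose_inverse_unique:
  assumes X: "is_moore_penrose_inverse M X" and Y: "is_moore_penrose_inverse M Y"
  shows "X = Y"
proof -
  note mp = X[unfolded is_moore_penrose_inverse_def] Y[unfolded is_moore_penrose_inverse_def]
  have "M ** X = (M ** Y ** M) ** X"
    using mp by simp
  also have "\<dots> = transpose (M ** Y) ** transpose (M ** X)"
    using mp by (simp add: matrix_mul_assoc)
  also have "\<dots> = transpose ((M ** X ** M) ** Y)"
    by (simp add: matrix_transpose_mul matrix_mul_assoc)
  also have "\<dots> = M ** Y"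
    using mp by simp
  finally have MX: "M ** X = M ** Y" .
  have "X ** M = X ** (M ** Y ** M)"
    using mp by simp
  also have "\<dots> = (X ** M) ** (Y ** M)"
    by (simp only: matrix_mul_assoc)
  also have "\<dots> = transpose (X ** M) ** transpose (Y ** M)"
    using mp by simp
  also have "\<dots> = transpose (Y ** (M ** X ** M))"
    by (simp add: matrix_transpose_mul matrix_mul_assoc)
  also have "\<dots> = Y ** M"
    using mp by simp
  finally have XM: "X ** M = Y ** M" .
  have "X = X ** M ** X"
    using mp by simp
  also have "\<dots> = Y ** (M ** X)"
    by (simp add: XM matrix_mul_assoc)
  also have "\<dots> = Y"
    using mp by (simp add: MX matrix_mul_assoc)
  finally show ?thesis .
qed

lemma moore_penrose_inverse_eqI:
  "is_moore_penrose_inverse M X \<Longrightarrow> moore_penrose_inverse M = X"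
  unfolding moore_penrose_inverse_def
  using is_moore_penrose_inverse_unique by blast

text \<open>The orthogonal projection onto the constant vectors, which form the kernel of the
  Laplacian of a connected graph.\<close>

definition averaging_matrix :: "real^'n^'n" where
  "averaging_matrix = (\<chi> i j. 1 / real CARD('n))"

lemma transpose_averaging_matrix: "transpose averaging_matrix = averaging_matrix"
  by (simp add: averaging_matrix_def transpose_def)

lemma averaging_matrix_idem: "averaging_matrix ** averaging_matrix = averaging_matrix"
  by (simp add: vec_eq_iff averaging_matrix_def matrix_matrix_mult_def)

section \<open>The Laplacian of a connected graph\<close>

locale connected_graph = pair_graph G for G :: "('v::finite) pair_pre_digraph" +
  assumes pverts_UNIV: "pverts G = UNIV"
    and connected_G: "Digraph_Component.connected (with_proj G)"
begin

abbreviation "L \<equiv> laplacian G"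

abbreviation "P \<equiv> moore_penrose_inverse (laplacian G)"

lemma neighborhood_eq: "neighborhood G i = {j. (i, j) \<in> parcs G}"
  by (simp add: neighborhood_def pverts_UNIV)

lemma vertex_degree_eq_card: "vertex_degree G i = card (neighborhood G i)"
proof -
  have "out_arcs (with_proj G) i = Pair i ` neighborhood G i"
    by (auto simp: out_arcs_def neighborhood_eq)
  then show ?thesis
    by (simp add: vertex_degree_def out_degree_def card_image inj_on_def)
qed

lemma arc_sym: "(i, j) \<in> parcs G \<longleftrightarrow> (j, i) \<in> parcs G"
  using arcs_symmetric by blast

lemma laplacian_entry:
  "L $ i $ j = (if i = j then real (vertex_degree G i) else 0) - of_bool (j \<in> neighborhood G i)"
  by (simp add: laplacian_def degree_matrix_def adjacency_matrix_def neighborhood_eq)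

lemma transpose_laplacian: "transpose L = L"
  by (auto simp: vec_eq_iff transpose_def laplacian_entry neighborhood_eq arc_sym)

lemma sum_laplacian_row:
  "(\<Sum>j\<in>UNIV. L $ k $ j * f j) =
    real (vertex_degree G k) * f k - (\<Sum>j\<in>neighborhood G k. f j)"
proof -
  have "(\<Sum>j\<in>UNIV. L $ k $ j * f j) = (\<Sum>j\<in>UNIV. (if k = j then real (vertex_degree G k) * f j else 0)
      - (if j \<in> neighborhood G k then f j else 0))"
    by (rule sum.cong) (auto simp: laplacian_entry algebra_simps)
  then show ?thesis
    by (simp add: sum_subtractf sum.delta flip: sum.inter_filter)
qed

lemma laplacian_mult_vector: "(L *v v) $ k = (\<Sum>l\<in>neighborhood G k. v $ k - v $ l)"
  by (simp add: matrix_vector_mult_def sum_laplacian_row vertex_degree_eq_card sum_subtractf)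

text \<open>Maximum principle: a neighbour of a vertex where \<open>v\<close> is maximal is again such a vertex.\<close>

lemma laplacian_kernel_constant:
  assumes "L *v v = 0"
  shows "v $ i = v $ j"
proof -
  define m where "m = Max (range (($) v))"
  have le: "v $ k \<le> m" for k
    by (simp add: m_def)
  have "m \<in> range (($) v)"
    unfolding m_def by (rule Max_in) auto
  then obtain a where a: "v $ a = m"
    by auto
  have max_step: "v $ l = m" if "v $ k = m" and "(k, l) \<in> parcs G" for k l
  proof -
    have "(\<Sum>l\<in>neighborhood G k. v $ k - v $ l) = 0"
      using assms by (simp flip: laplacian_mult_vector)
    then have "\<forall>l\<in>neighborhood G k. v $ k - v $ l = 0"
      using le that(1) by (subst (asm) sum_nonneg_eq_0_iff) auto
    then show ?thesis
      using that by (auto simp: neighborhood_eq)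
  qed
  have "v $ k = m" for k
  proof -
    \<comment> \<open>Connectedness means reachability in the symmetric closure; as arcs of
      \<open>G\<close> come in opposite pairs, each step of such a walk is an arc of
      \<open>G\<close>.\<close>
    have "(a, k) \<in> rtrancl_on UNIV (parcs (mk_symmetric (with_proj G)))"
      using connected_G pverts_UNIV
      by (simp add: Digraph_Component.connected_def strongly_connected_def reachable_def)
    then show ?thesis
    proof (induction rule: rtrancl_on_induct)
      case (step k l)
      then have "(k, l) \<in> parcs G"
        using arc_sym by (auto simp: parcs_mk_symmetric)
      with step.IH show ?case
        by (rule max_step)
    qed (simp_all add: a)
  qed
  then show ?thesis
    by simp
qed

lemma laplacian_averaging: "L ** averaging_matrix = 0"
  using sum_laplacian_row[of _ "\<lambda>_. 1 / real CARD('v)"]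
  by (simp add: vec_eq_iff matrix_matrix_mult_def averaging_matrix_def vertex_degree_eq_card)

lemma averaging_laplacian: "averaging_matrix ** L = 0"
proof -
  have "averaging_matrix ** L = transpose (L ** averaging_matrix)"
    by (simp add: matrix_transpose_mul transpose_laplacian transpose_averaging_matrix)
  then show ?thesis
    by (simp add: laplacian_averaging vec_eq_iff transpose_def)
qed

text \<open>Multiplying by the averaging matrix kills the Laplacian part, so \<open>v\<close> has
  mean zero. Then \<open>L *v v = 0\<close> makes \<open>v\<close> constant, hence zero.\<close>

lemma laplacian_add_averaging_kernel:
  assumes "(L + averaging_matrix) *v v = 0"
  shows "v = 0"
proof -
  have "averaging_matrix *v v = averaging_matrix *v ((L + averaging_matrix) *v v)"
    by (simp add: matrix_vector_mul_assoc matrix_add_ldistrib averaging_laplacian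
        averaging_matrix_idem)
  then have avg: "(averaging_matrix :: real^'v^'v) *v v = 0"
    using assms by simp
  then have "L *v v = 0"
    using assms by (simp add: matrix_vector_mult_add_rdistrib)
  then have const: "v $ i = v $ j" for i j
    by (rule laplacian_kernel_constant)
  have "v $ i = 0" for i
  proof -
    have "((averaging_matrix :: real^'v^'v) *v v) $ i = (\<Sum>j\<in>(UNIV :: 'v set). v $ i / real CARD('v))"
      unfolding matrix_vector_mult_def averaging_matrix_def vec_lambda_beta
      by (rule sum.cong) (use const[of _ i] in auto)
    then show ?thesis
      using avg by simp
  qed
  then show ?thesis
    by (simp add: vec_eq_iff)
qed

lemma laplacian_pseudoinverse_exists:
  obtains X where "is_moore_penrose_inverse L X" and "L ** X = mat 1 - averaging_matrix"
    and "transpose X = X" and "X ** averaging_matrix = 0"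
proof -
  let ?K = "averaging_matrix :: real^'v^'v"
  let ?M = "L + ?K"
  \<comment> \<open>A trivial kernel gives a left inverse, which is two-sided because the matrix is
    square.\<close>
  obtain B where BM: "B ** ?M = mat 1"
    using laplacian_add_averaging_kernel matrix_left_invertible_ker[of ?M] by blast
  then have MB: "?M ** B = mat 1"
    using matrix_left_right_inverse by blast
  have trM: "transpose ?M = ?M"
    using transpose_laplacian transpose_averaging_matrix
    by (simp add: vec_eq_iff transpose_def)
  have trB: "transpose B = B"
  proof -
    have "transpose B = transpose B ** (?M ** B)"
      by (simp add: MB)
    also have "\<dots> = transpose (?M ** B) ** B"
      by (simp only: matrix_transpose_mul trM matrix_mul_assoc)
    also have "\<dots> = B"
      by (simp add: MB)
    finally show ?thesis .
  qed
  have MK: "?M ** ?K = ?K"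
    by (simp add: matrix_add_rdistrib laplacian_averaging averaging_matrix_idem)
  \<comment> \<open>Since \<open>?M\<close> fixes \<open>?K\<close>, so does its inverse
    \<open>B\<close>; symmetry then gives \<open>KB\<close>.\<close>
  have BK: "B ** ?K = ?K"
    using BM by (metis MK matrix_mul_assoc matrix_mul_lid)
  have KB: "?K ** B = ?K"
    by (metis BK matrix_transpose_mul transpose_averaging_matrix trB)
  define X where "X = B - ?K"
  have trX: "transpose X = X"
    by (simp add: X_def transpose_diff trB transpose_averaging_matrix)
  have XK: "X ** ?K = 0"
    by (simp add: X_def matrix_diff_rdistrib BK averaging_matrix_idem)
  have "L ** B = mat 1 - ?K"
    using MB KB by (simp add: matrix_add_rdistrib eq_diff_eq)
  then have LX: "L ** X = mat 1 - ?K"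
    by (simp add: X_def matrix_diff_ldistrib laplacian_averaging)
  have "X ** L = transpose (L ** X)"
    by (simp add: matrix_transpose_mul trX transpose_laplacian)
  then have XL: "X ** L = mat 1 - ?K"
    by (simp add: LX transpose_diff transpose_averaging_matrix)
  \<comment> \<open>With both products equal to \<open>mat 1 - ?K\<close>, the Penrose equations
    reduce to \<open>?K ** L = 0\<close>, \<open>?K ** X = 0\<close> and the symmetry of
    \<open>?K\<close>.\<close>
  have "is_moore_penrose_inverse L X"
    unfolding is_moore_penrose_inverse_def LX XL
    by (simp add: matrix_diff_rdistrib averaging_laplacian transpose_diff
        transpose_averaging_matrix flip: matrix_mul_assoc)
      (simp add: X_def matrix_diff_ldistrib KB averaging_matrix_idem)
  then show thesis
    using that LX trX XK by blast
qed

lemma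
  shows laplacian_mult_pseudoinverse: "L ** P = mat 1 - averaging_matrix"
    and transpose_laplacian_pseudoinverse: "transpose P = P"
    and laplacian_pseudoinverse_averaging: "P ** averaging_matrix = 0"
  by (metis laplacian_pseudoinverse_exists moore_penrose_inverse_eqI)+

lemma laplacian_pseudoinverse_sym: "P $ i $ j = P $ j $ i"
  by (metis transpose_laplacian_pseudoinverse transpose_def vec_lambda_beta)

lemma sum_laplacian_pseudoinverse_row: "(\<Sum>j\<in>UNIV. P $ i $ j) = 0"
proof -
  have "(P ** averaging_matrix) $ i $ i = (\<Sum>j\<in>UNIV. P $ i $ j) / real CARD('v)"
    by (simp add: matrix_matrix_mult_def averaging_matrix_def sum_divide_distrib)
  then show ?thesis
    by (simp add: laplacian_pseudoinverse_averaging)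
qed

text \<open>The \<open>i\<close>-th diagonal entry of
  \<open>L ** P = mat 1 - averaging_matrix\<close>; symmetry of \<open>P\<close> turns its column
  \<open>i\<close> into row \<open>i\<close>.\<close>

lemma sum_neighborhood_laplacian_pseudoinverse:
  "(\<Sum>j\<in>neighborhood G i. P $ i $ j) =
    real (vertex_degree G i) * P $ i $ i - 1 + 1 / real CARD('v)"
proof -
  have "1 - 1 / real CARD('v) = (L ** P) $ i $ i"
    by (simp add: laplacian_mult_pseudoinverse mat_def averaging_matrix_def)
  also have "\<dots> = (\<Sum>j\<in>UNIV. L $ i $ j * P $ i $ j)"
    by (simp add: matrix_matrix_mult_def laplacian_pseudoinverse_sym[of i])
  finally show ?thesis
    by (simp add: sum_laplacian_row)
qed

section \<open>Resistances\<close>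

lemma unit_current_potential_iff:
  "unit_current_potential G s t p \<longleftrightarrow> L *v (\<chi> k. p k) = axis s 1 - axis t 1"
  by (simp add: unit_current_potential_def pverts_UNIV vec_eq_iff laplacian_mult_vector axis_def
      of_bool_def)

text \<open>The potential is \<open>P\<close> applied to the external current. That current has
  total zero, so the projection \<open>L ** P\<close> leaves it unchanged.\<close>

lemma unit_current_potential_pseudoinverse:
  "unit_current_potential G s t (\<lambda>k. P $ k $ s - P $ k $ t)"
proof -
  have "(\<chi> k. P $ k $ s - P $ k $ t) = P *v (axis s 1 - axis t 1)"
    by (simp add: vec_eq_iff matrix_vector_mult_diff_distrib matrix_vector_mul_component
        matrix_vector_mult_basis column_def)
  then have "L *v (\<chi> k. P $ k $ s - P $ k $ t) =
      (mat 1 - averaging_matrix) *v (axis s 1 - axis t 1)"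
    by (simp add: matrix_vector_mul_assoc laplacian_mult_pseudoinverse)
  also have "\<dots> = axis s 1 - axis t 1"
    by (simp only: matrix_vector_mult_diff_distrib matrix_vector_mult_basis)
      (simp add: column_def averaging_matrix_def vec_eq_iff mat_def axis_def)
  finally show ?thesis
    by (simp add: unit_current_potential_iff)
qed

text \<open>Two potentials differ by a vector in the kernel of \<open>L\<close>, that is, by a
  constant.\<close>

lemma unit_current_potential_difference_unique:
  assumes "unit_current_potential G s t p" and "unit_current_potential G s t q"
  shows "p s - p t = q s - q t"
proof -
  have "L *v ((\<chi> k. p k) - (\<chi> k. q k)) = 0"
    using assms by (simp add: unit_current_potential_iff matrix_vector_mult_diff_distrib)
  from laplacian_kernel_constant[OF this, of s t] show ?thesis
    by simp
qed

lemma resistance_distance_eq: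
  "resistance_distance G i j = P $ i $ i + P $ j $ j - 2 * P $ i $ j"
proof -
  have "resistance_distance G i j = (P $ i $ i - P $ i $ j) - (P $ j $ i - P $ j $ j)"
    unfolding resistance_distance_def
    using unit_current_potential_pseudoinverse[of i j] unit_current_potential_difference_unique
    by (intro the_equality) blast+
  then show ?thesis
    by (simp add: laplacian_pseudoinverse_sym[of j i])
qed

text \<open>The mixed terms \<open>P $ i $ j\<close> cancel because the rows of \<open>P\<close> sum
  to zero.\<close>

lemma sum_resistance_distance_row:
  "(\<Sum>j\<in>UNIV. resistance_distance G i j) = real CARD('v) * P $ i $ i + trace P"
  by (simp add: resistance_distance_eq sum_subtractf sum.distrib trace_def
      sum_laplacian_pseudoinverse_row flip: sum_distrib_left)

lemma kirchhoff_index_eq: "kirchhoff_index G = real CARD('v) * trace P"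
proof -
  have "(\<Sum>i\<in>UNIV. \<Sum>j\<in>UNIV. resistance_distance G i j) = 2 * (real CARD('v) * trace P)"
    by (simp add: sum_resistance_distance_row sum.distrib trace_def flip: sum_distrib_left)
  then show ?thesis
    by (simp add: kirchhoff_index_def pverts_UNIV)
qed

lemma resistance_regular_iff:
  "resistance_regular G \<longleftrightarrow> (\<forall>i. P $ i $ i = trace P / real CARD('v))"
proof
  assume "resistance_regular G"
  then obtain c where c: "real CARD('v) * P $ i $ i + trace P = c" for i
    by (auto simp: resistance_regular_def pverts_UNIV resistance_matrix_def
        sum_resistance_distance_row)
  have eq: "P $ i $ i = P $ j $ j" for i j
  proof -
    have "real CARD('v) * P $ i $ i = real CARD('v) * P $ j $ j"
      using c[of i] c[of j] by linarith
    then show ?thesis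
      by simp
  qed
  \<comment> \<open>A constant diagonal must equal its own mean, which identifies the
    constant.\<close>
  have "trace P = real CARD('v) * P $ i $ i" for i
  proof -
    have "trace P = (\<Sum>j\<in>(UNIV :: 'v set). P $ i $ i)"
      unfolding trace_def by (rule sum.cong) (use eq in blast)+
    then show ?thesis
      by simp
  qed
  then show "\<forall>i. P $ i $ i = trace P / real CARD('v)"
    by (intro allI) (simp add: eq_divide_eq mult.commute)
next
  assume "\<forall>i. P $ i $ i = trace P / real CARD('v)"
  then show "resistance_regular G"
    by (simp add: resistance_regular_def pverts_UNIV resistance_matrix_def
        sum_resistance_distance_row)
qed

text \<open>Without edges every vector lies in the kernel of \<open>L\<close>, even the unit vector
  at \<open>i\<close>; but kernel vectors are constant. This serves the case where the degree cannot
  be cancelled.\<close>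

lemma regular_graph_degree_zero_imp_single:
  assumes "regular_graph G 0"
  shows "(i :: 'v) = j"
proof -
  have "neighborhood G k = {}" for k
    using assms by (simp add: regular_graph_def pverts_UNIV vertex_degree_eq_card)
  then have "L *v axis i 1 = 0"
    by (simp add: vec_eq_iff laplacian_mult_vector)
  from laplacian_kernel_constant[OF this, of i j] show ?thesis
    by (auto simp: axis_def split: if_splits)
qed

end

theorem corollary2p32:
  fixes G :: "('v::finite) pair_pre_digraph" and n d :: nat
  assumes "pair_graph G"
    and "pverts G = UNIV"
    and "Digraph_Component.connected (with_proj G)"
    and "regular_graph G d"
    and "n = card (pverts G)"
  shows "resistance_regular G \<longleftrightarrow>
    (\<forall>i\<in>pverts G. (\<Sum>j\<in>neighborhood G i. moore_penrose_inverse (laplacian G) $ i $ j)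
        = real d / (real n)\<^sup>2 * kirchhoff_index G + 1 / real n - 1)"
proof -
  interpret connected_graph G
    using assms by (simp add: connected_graph_def connected_graph_axioms_def)
  have n: "n = CARD('v)" "real n \<noteq> 0"
    using assms by auto
  have deg: "vertex_degree G i = d" for i
    using assms by (simp add: regular_graph_def)
  have "real d / (real n)\<^sup>2 * kirchhoff_index G = real d * (trace P / real n)"
    using n by (simp add: kirchhoff_index_eq power2_eq_square)
  then have "(\<Sum>j\<in>neighborhood G i. P $ i $ j)
        = real d / (real n)\<^sup>2 * kirchhoff_index G + 1 / real n - 1 \<longleftrightarrow>
      real d * P $ i $ i = real d * (trace P / real n)" for i
    by (simp add: sum_neighborhood_laplacian_pseudoinverse deg algebra_simps flip: n(1))
  moreover have "(\<forall>i. real d * P $ i $ i = real d * (trace P / real n)) \<longleftrightarrow>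
      (\<forall>i. P $ i $ i = trace P / real n)"
  \<comment> \<open>For positive \<open>d\<close> the factor cancels. For \<open>d = 0\<close> the
    left side is trivially true, and the right side holds because the only diagonal entry is the
    trace.\<close>
  proof (cases "d = 0")
    case True
    have "P $ i $ i = trace P / real n" for i
    proof -
      have single: "(UNIV :: 'v set) = {i}"
        using regular_graph_degree_zero_imp_single[of _ i] assms(4) True by blast
      then show ?thesis
        unfolding trace_def n(1) single by simp
    qed
    then show ?thesis
      by simp
  next
    case False
    then show ?thesis
      by (simp only: mult_cancel_left of_nat_eq_0_iff simp_thms)
  qed
  ultimately show ?thesis
    using n assms(2) by (simp add: resistance_regular_iff)
qed

end
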